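(* Restricting an element of $\mathbf{F}^*_n$ to singletons defines a homomorphism from $\mathbf{F}^*_n$ to $\mathbf{IS}_n$, denoted $\upsilon$. The image of $\upsilon$ coincides with $\widetilde{\mathbf{IS}}_n$.
   Context: Let $n\ge1$ and $\underline{n}=\{1,\dots,n\}$. $\mathbf{I}^*_n$ is the dual symmetric inverse monoid: the set of all bijections from the set of blocks of a set partition $A_1\sqcup\dots\sqcup A_k$ of $\underline n$ to the set of blocks of a set partition $B_1\sqcup\dots\sqcup B_k$ of $\underline{n}$. The product $\alpha\beta$ (first $\beta:P\to Q$, then $\alpha:R\to T$, where $P,Q,R,T$ are partitions) is obtained by taking the join $J$ of $Q$ and $R$ (finest partition coarser than both) and sending, for each block $X$ of $J$, the union of the blocks $\beta^{-1}(Y)$, $Y\in Q$, $Y\subset X$, to the union of the blocks $\alpha(Z)$, $Z\in R$, $Z\subset X$. $\mathbf{F}^*_n$ is the submonoid of $\mathbf{I}^*_n$ consisting of those bijections which send each block to a block of the same cardinality. $\mathbf{IS}_n$ is the symmetric inverse monoid of all bijections between subsets of $\underline{n}$, under composition of partial maps. The rank of such a bijection is the cardinality of its domain, and $\widetilde{\mathbf{IS}}_n$ is the submonoid of $\mathbf{IS}_n$ of all elements whose rank is different from $n-1$. Restricting $\alpha\in\mathbf{F}^*_n$ to singletons means taking the partial bijection $x\mapsto y$, defined for those $x$ such that $\{x\}$ is a block of the domain partition of $\alpha$, where $\alpha(\{x\})=\{y\}$. *)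

theory Defs
  imports "HOL-Library.Disjoint_Sets" "HOL-Algebra.Group"
begin

text \<open>
  A bijection between two sets is represented by its graph, so that its domain and its
  image are the library's \<^const>\<open>Domain\<close> and \<^const>\<open>Range\<close>.
\<close>

definition bij_graphs :: "'a set \<Rightarrow> 'b set \<Rightarrow> ('a \<times> 'b) set set" where
  "bij_graphs P Q = {(\<lambda>x. (x, f x)) ` P | f. bij_betw f P Q}"

definition is_partition_join :: "'a set \<Rightarrow> 'a set set \<Rightarrow> 'a set set \<Rightarrow> 'a set set \<Rightarrow> bool" where
  "is_partition_join A P Q J \<longleftrightarrow> refines A P J \<and> refines A Q J \<and>
     (\<forall>K. refines A P K \<and> refines A Q K \<longrightarrow> refines A J K)"

definition partition_join :: "'a set \<Rightarrow> 'a set set \<Rightarrow> 'a set set \<Rightarrow> 'a set set" where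
  "partition_join A P Q = (THE J. is_partition_join A P Q J)"

lemma ex_partition_join:
  assumes P: "partition_on A P" and Q: "partition_on A Q"
  shows "\<exists>J. is_partition_join A P Q J"
proof -
  obtain r s where r: "equiv A r" "P = A // r" and s: "equiv A s" "Q = A // s"
    using P Q unfolding partition_on_alt by blast
  define t where "t = (r \<union> s)\<^sup>+"
  have rs: "r \<union> s \<subseteq> A \<times> A"
    using equiv_type[OF r(1)] equiv_type[OF s(1)] by blast
  have "t \<subseteq> A \<times> A"
    unfolding t_def using rs by (rule trancl_subset_Sigma)
  moreover have "refl_on A t"
    using r(1) unfolding t_def equiv_def refl_on_def by blast
  moreover have "sym t"
    unfolding t_def using r(1) s(1) by (intro sym_trancl sym_Un) (auto simp: equiv_def)
  moreover have "trans t"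
    unfolding t_def by simp
  ultimately have t: "equiv A t"
    by (simp add: equiv_def)
  have J: "partition_on A (A // t)"
    using t by (rule partition_on_quotient)
  have sub: "refines A (A // u) (A // v)" if "equiv A u" "equiv A v" "u \<subseteq> v" for u v
    unfolding refines_def
  proof (intro conjI ballI)
    fix X assume "X \<in> A // u"
    then obtain x where x: "x \<in> A" "X = u `` {x}"
      by (rule quotientE)
    then show "\<exists>Y\<in>A // v. X \<subseteq> Y"
      using that(3) by (intro bexI[of _ "v `` {x}"] quotientI) auto
  qed (use that partition_on_quotient in auto)
  have "r \<subseteq> t" "s \<subseteq> t"
    unfolding t_def by auto
  then have "refines A P (A // t)" "refines A Q (A // t)"
    using sub[OF r(1) t] sub[OF s(1) t] r(2) s(2) by auto
  moreover have "refines A (A // t) K" if PK: "refines A P K" and QK: "refines A Q K" for K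
  proof -
    obtain k where k: "equiv A k" "K = A // k"
      using PK unfolding refines_def partition_on_alt by blast
    have *: "u \<subseteq> k" if u: "equiv A u" and ref: "refines A (A // u) K" for u
    proof clarify
      fix x y assume xy: "(x, y) \<in> u"
      then have x: "x \<in> A"
        using equiv_type[OF u] by blast
      then obtain Y where Y: "Y \<in> K" "u `` {x} \<subseteq> Y"
        using ref unfolding refines_def by (blast intro: quotientI)
      have "x \<in> Y" "y \<in> Y"
        using Y(2) xy equiv_class_self[OF u x] by auto
      then show "(x, y) \<in> k"
        using quotient_eq_iff[OF k(1), of Y Y x y] Y(1) k(2) by simp
    qed
    have "r \<union> s \<subseteq> k"
      using *[OF r(1)] *[OF s(1)] PK QK r(2) s(2) by auto
    then have "t \<subseteq> k"
      unfolding t_def using k(1) by (metis equiv_def trancl_id trancl_mono_subset)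
    then show ?thesis
      using sub[OF t k(1)] k(2) by simp
  qed
  ultimately show ?thesis
    unfolding is_partition_join_def by blast
qed

lemma is_partition_join_partition_join:
  assumes "partition_on A P" "partition_on A Q"
  shows "is_partition_join A P Q (partition_join A P Q)"
  unfolding partition_join_def
proof (rule theI')
  show "\<exists>!J. is_partition_join A P Q J"
    using ex_partition_join[OF assms] refines_asym unfolding is_partition_join_def by metis
qed

text \<open>
  Products are read from right to left: in \<open>\<alpha> \<otimes> \<beta>\<close> the bijection \<open>\<beta>\<close> is applied first.
\<close>

definition dual_mult :: "nat \<Rightarrow> (nat set \<times> nat set) set \<Rightarrow> (nat set \<times> nat set) set
    \<Rightarrow> (nat set \<times> nat set) set" where
  "dual_mult n \<alpha> \<beta> =
     {(\<Union>{A. \<exists>Y. (A, Y) \<in> \<beta> \<and> Y \<subseteq> X}, \<Union>{B. \<exists>Z. (Z, B) \<in> \<alpha> \<and> Z \<subseteq> X}) | X.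
        X \<in> partition_join {1..n} (Range \<beta>) (Domain \<alpha>)}"

definition I_star :: "nat \<Rightarrow> (nat set \<times> nat set) set monoid" where
  "I_star n =
     \<lparr>carrier = \<Union>{bij_graphs P Q | P Q. partition_on {1..n} P \<and> partition_on {1..n} Q},
      mult = dual_mult n,
      one = {({x}, {x}) | x. x \<in> {1..n}}\<rparr>"

definition F_star :: "nat \<Rightarrow> (nat set \<times> nat set) set monoid" where
  "F_star n = (I_star n)
     \<lparr>carrier := {\<alpha> \<in> carrier (I_star n). \<forall>(A, B) \<in> \<alpha>. card A = card B}\<rparr>"

text \<open>
  The relational composition \<open>\<beta> O \<alpha>\<close> applies \<open>\<beta>\<close> first.
\<close>

definition IS :: "nat \<Rightarrow> (nat \<times> nat) set monoid" where
  "IS n =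
     \<lparr>carrier = \<Union>{bij_graphs A B | A B. A \<subseteq> {1..n} \<and> B \<subseteq> {1..n}},
      mult = (\<lambda>\<alpha> \<beta>. \<beta> O \<alpha>),
      one = Id_on {1..n}\<rparr>"

definition rank :: "(nat \<times> nat) set \<Rightarrow> nat" where
  "rank \<sigma> = card (Domain \<sigma>)"

definition IS_tilde :: "nat \<Rightarrow> (nat \<times> nat) set monoid" where
  "IS_tilde n = (IS n)\<lparr>carrier := {\<sigma> \<in> carrier (IS n). rank \<sigma> \<noteq> n - 1}\<rparr>"

text \<open>
  For block bijections that preserve cardinalities, a singleton block of the domain
  partition is always sent to a singleton.
\<close>

definition upsilon :: "(nat set \<times> nat set) set \<Rightarrow> (nat \<times> nat) set" where
  "upsilon \<alpha> = {(x, y). ({x}, {y}) \<in> \<alpha>}"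

end

theory Submission
  imports Defs
begin

text \<open>
  The homomorphism property comes down to one observation about a block \<open>X\<close> of the join of the
  middle partitions \<open>Range \<beta>\<close> and \<open>Domain \<alpha>\<close>: it produces a pair of singletons in the product
  exactly when \<open>X\<close> is itself a singleton \<open>{z}\<close> that is a block of both partitions. If \<open>{z}\<close> is a
  common block, then the partition into \<open>{z}\<close> and the remaining points is coarser than both, so
  that the join keeps \<open>{z}\<close> apart (\<open>singleton_in_join\<close>). Conversely, \<open>X\<close> is a disjoint union of
  blocks of \<open>Range \<beta>\<close>; if their preimages fill up only a singleton \<open>{x}\<close>, then there is only one
  of them, and preservation of cardinality makes it a singleton
  (\<open>upsilon_dual_mult\<close>).

  The rank \<open>n - 1\<close> cannot occur, because a partition of which all but one point form singleton
  blocks also has the last point as a singleton block (\<open>rank_upsilon\<close>). Every other partial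
  bijection extends to a block bijection by sending the complement of its domain, as one block,
  to the complement of its range. These two complements have the same size, and this size is
  not 1, so that the added block is invisible to the restriction to singletons
  (\<open>upsilon_complete_blocks\<close>).
\<close>

section \<open>Graphs of bijections\<close>

text \<open>
  In this relational form, carriers can be checked on the pairs alone, without naming the
  underlying functions or the two partitions.
\<close>

lemma mem_bij_graphs_iff:
  "r \<in> bij_graphs P Q \<longleftrightarrow>
     Domain r = P \<and> Range r = Q \<and> single_valued r \<and> single_valued (r\<inverse>)"
proof
  assume "r \<in> bij_graphs P Q"
  then show "Domain r = P \<and> Range r = Q \<and> single_valued r \<and> single_valued (r\<inverse>)"
    by (auto simp: bij_graphs_def bij_betw_def single_valued_def inj_on_def)
next
  assume *: "Domain r = P \<and> Range r = Q \<and> single_valued r \<and> single_valued (r\<inverse>)"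
  define f where "f x = (THE y. (x, y) \<in> r)" for x
  have f: "f x = y" if "(x, y) \<in> r" for x y
    using that * unfolding f_def single_valued_def by blast
  have "r = (\<lambda>x. (x, f x)) ` P"
    using * f by force
  moreover have "bij_betw f P Q"
    unfolding bij_betw_def
  proof
    show "inj_on f P"
      using * f unfolding inj_on_def single_valued_def by (metis DomainE converse_iff)
    show "f ` P = Q"
      using * f by force
  qed
  ultimately show "r \<in> bij_graphs P Q"
    unfolding bij_graphs_def by blast
qed

lemma card_eq_of_bij_graph:
  assumes "r \<in> bij_graphs P Q"
  shows "card P = card Q"
  using assms by (auto simp: bij_graphs_def intro: bij_betw_same_card)

lemma mem_carrier_IS_iff:
  "\<sigma> \<in> carrier (IS n) \<longleftrightarrow>
     Domain \<sigma> \<subseteq> {1..n} \<and> Range \<sigma> \<subseteq> {1..n} \<and> single_valued \<sigma> \<and> single_valued (\<sigma>\<inverse>)"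
proof -
  have "\<sigma> \<in> carrier (IS n) \<longleftrightarrow>
      (\<exists>A B. \<sigma> \<in> bij_graphs A B \<and> A \<subseteq> {1..n} \<and> B \<subseteq> {1..n})"
    unfolding IS_def by auto
  then show ?thesis
    unfolding mem_bij_graphs_iff by metis
qed

lemma mem_carrier_F_star_iff:
  "\<alpha> \<in> carrier (F_star n) \<longleftrightarrow>
     partition_on {1..n} (Domain \<alpha>) \<and> partition_on {1..n} (Range \<alpha>) \<and>
     single_valued \<alpha> \<and> single_valued (\<alpha>\<inverse>) \<and> (\<forall>(A, B) \<in> \<alpha>. card A = card B)"
proof -
  have "\<alpha> \<in> carrier (F_star n) \<longleftrightarrow>
      (\<exists>P Q. \<alpha> \<in> bij_graphs P Q \<and> partition_on {1..n} P \<and> partition_on {1..n} Q) \<and>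
      (\<forall>(A, B) \<in> \<alpha>. card A = card B)"
    unfolding F_star_def I_star_def by auto
  then show ?thesis
    unfolding mem_bij_graphs_iff by metis
qed

section \<open>Blocks of the join\<close>

lemma block_of_join_as_union:
  assumes "refines S P J" and "X \<in> J"
  shows "X = \<Union>{Y \<in> P. Y \<subseteq> X}"
proof
  show "X \<subseteq> \<Union>{Y \<in> P. Y \<subseteq> X}"
  proof
    fix x assume x: "x \<in> X"
    have P: "partition_on S P" and J: "partition_on S J"
      using assms(1) by (auto simp: refines_def)
    obtain Y where Y: "Y \<in> P" "x \<in> Y"
      using x assms(2) partition_onD1[OF P] partition_onD1[OF J] by blast
    then obtain X' where "X' \<in> J" "Y \<subseteq> X'"
      using assms(1) by (auto simp: refines_def)
    then have "X' = X"
      using x Y assms(2) partition_onD2[OF J] by (auto dest: disjointD)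
    with Y \<open>Y \<subseteq> X'\<close> show "x \<in> \<Union>{Y \<in> P. Y \<subseteq> X}"
      by blast
  qed
qed blast

lemma refines_isolating_singleton:
  assumes P: "partition_on S P" and z: "{z} \<in> P"
  shows "refines S P ({{z}, S - {z}} - {{}})"
  unfolding refines_def
proof (intro conjI ballI P)
  have "z \<in> S"
    using partition_onD1[OF P] z by blast
  then show "partition_on S ({{z}, S - {z}} - {{}})"
    by (auto simp: partition_on_def disjoint_def)
  fix X assume X: "X \<in> P"
  show "\<exists>Y\<in>{{z}, S - {z}} - {{}}. X \<subseteq> Y"
  proof (cases "X = {z}")
    case False
    then have "X \<inter> {z} = {}"
      using disjointD[OF partition_onD2[OF P] X z] by blast
    moreover have "X \<noteq> {}" "X \<subseteq> S"
      using P X by (auto simp: partition_on_def)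
    ultimately show ?thesis
      by blast
  qed auto
qed

text \<open>
  By minimality the join refines the partition of the previous lemma, so that its block through
  \<open>z\<close> cannot contain any other point.
\<close>

lemma singleton_in_join:
  assumes P: "partition_on S P" and Q: "partition_on S Q" and z: "{z} \<in> P" "{z} \<in> Q"
  shows "{z} \<in> partition_join S P Q"
proof -
  have join: "is_partition_join S P Q (partition_join S P Q)"
    using P Q by (rule is_partition_join_partition_join)
  then have "refines S P (partition_join S P Q)"
    by (simp add: is_partition_join_def)
  then obtain X where X: "X \<in> partition_join S P Q" "{z} \<subseteq> X"
    using z(1) unfolding refines_def by metis
  have "refines S (partition_join S P Q) ({{z}, S - {z}} - {{}})"
    using join refines_isolating_singleton[OF P z(1)] refines_isolating_singleton[OF Q z(2)]
    by (simp add: is_partition_join_def)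
  with X(1) have "X \<subseteq> {z} \<or> X \<subseteq> S - {z}"
    unfolding refines_def by (metis DiffD1 insertE singletonD)
  with X have "X = {z}"
    by blast
  with X show ?thesis
    by simp
qed

section \<open>Restriction to singletons is multiplicative\<close>

lemma upsilon_in_carrier_IS:
  assumes "\<alpha> \<in> carrier (F_star n)"
  shows "upsilon \<alpha> \<in> carrier (IS n)"
proof -
  have P: "partition_on {1..n} (Domain \<alpha>)" "partition_on {1..n} (Range \<alpha>)"
    and sv: "single_valued \<alpha>" "single_valued (\<alpha>\<inverse>)"
    using assms by (auto simp: mem_carrier_F_star_iff)
  have "Domain (upsilon \<alpha>) \<subseteq> {1..n}"
    unfolding partition_onD1[OF P(1)] upsilon_def by blast
  moreover have "Range (upsilon \<alpha>) \<subseteq> {1..n}"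
    unfolding partition_onD1[OF P(2)] upsilon_def by blast
  moreover have "single_valued (upsilon \<alpha>)" "single_valued ((upsilon \<alpha>)\<inverse>)"
    using sv unfolding single_valued_def upsilon_def by (blast dest: singleton_inject)+
  ultimately show ?thesis
    by (simp add: mem_carrier_IS_iff)
qed

lemma upsilon_dual_mult:
  assumes \<alpha>: "\<alpha> \<in> carrier (F_star n)" and \<beta>: "\<beta> \<in> carrier (F_star n)"
  shows "upsilon (dual_mult n \<alpha> \<beta>) = upsilon \<beta> O upsilon \<alpha>"
proof -
  let ?J = "partition_join {1..n} (Range \<beta>) (Domain \<alpha>)"
  let ?pre = "\<lambda>X. {A. \<exists>Y. (A, Y) \<in> \<beta> \<and> Y \<subseteq> X}"
  let ?img = "\<lambda>X. {B. \<exists>Z. (Z, B) \<in> \<alpha> \<and> Z \<subseteq> X}"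
  have "dual_mult n \<alpha> \<beta> = (\<lambda>X. (\<Union>(?pre X), \<Union>(?img X))) ` ?J"
    unfolding dual_mult_def by (rule Setcompr_eq_image)
  then have mult: "({x}, {y}) \<in> dual_mult n \<alpha> \<beta> \<longleftrightarrow>
      (\<exists>X\<in>?J. {x} = \<Union>(?pre X) \<and> {y} = \<Union>(?img X))" for x y
    by (simp only: image_iff prod.inject)
  have parts: "partition_on {1..n} (Domain \<beta>)" "partition_on {1..n} (Range \<beta>)"
      "partition_on {1..n} (Domain \<alpha>)" "partition_on {1..n} (Range \<alpha>)"
    and sv\<beta>: "single_valued \<beta>" "single_valued (\<beta>\<inverse>)"
    and sv\<alpha>: "single_valued \<alpha>" "single_valued (\<alpha>\<inverse>)"
    and card\<beta>: "\<And>A B. (A, B) \<in> \<beta> \<Longrightarrow> card A = card B"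
    using \<alpha> \<beta> by (auto simp: mem_carrier_F_star_iff)
  have ne: "A \<noteq> {} \<and> B \<noteq> {}" if "(A, B) \<in> \<beta> \<or> (A, B) \<in> \<alpha>" for A B
    using that parts by (auto simp: partition_on_def)
  have join: "refines {1..n} (Range \<beta>) ?J" "refines {1..n} (Domain \<alpha>) ?J"
    using is_partition_join_partition_join[OF parts(2,3)]
    by (auto simp: is_partition_join_def)
  have "({x}, {y}) \<in> dual_mult n \<alpha> \<beta> \<longleftrightarrow> (\<exists>z. ({x}, {z}) \<in> \<beta> \<and> ({z}, {y}) \<in> \<alpha>)" for x y
  proof
    assume "({x}, {y}) \<in> dual_mult n \<alpha> \<beta>"
    then obtain X where X: "X \<in> ?J" and pre: "{x} = \<Union>(?pre X)" and img: "{y} = \<Union>(?img X)"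
      unfolding mult by (elim bexE conjE)
    have pre_x: "A = {x}" if "(A, Y) \<in> \<beta>" "Y \<subseteq> X" for A Y
    proof -
      have "A \<subseteq> {x}"
        unfolding pre using that by blast
      then show ?thesis
        using ne that(1) by blast
    qed
    have img_y: "B = {y}" if "(Z, B) \<in> \<alpha>" "Z \<subseteq> X" for Z B
    proof -
      have "B \<subseteq> {y}"
        unfolding img using that by blast
      then show ?thesis
        using ne that(1) by blast
    qed
    obtain Y where Y: "({x}, Y) \<in> \<beta>" "Y \<subseteq> X"
      using pre pre_x by blast
    \<comment> \<open>All blocks of \<open>Range \<beta>\<close> inside \<open>X\<close> are images of \<open>{x}\<close>, hence equal to \<open>Y\<close>.\<close>
    have "{Y' \<in> Range \<beta>. Y' \<subseteq> X} = {Y}"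
      using Y pre_x sv\<beta>(1) unfolding single_valued_def by blast
    then have "X = Y"
      using block_of_join_as_union[OF join(1) X] by simp
    moreover obtain z where "Y = {z}"
      using card\<beta>[OF Y(1)] by (metis card_1_singletonE is_singletonI is_singleton_altdef)
    ultimately have z: "X = {z}" "({x}, {z}) \<in> \<beta>"
      using Y by auto
    obtain Z B where Z: "(Z, B) \<in> \<alpha>" "Z \<subseteq> X"
      using img by blast
    then have "Z = {z}"
      using z ne by blast
    with z Z img_y show "\<exists>z. ({x}, {z}) \<in> \<beta> \<and> ({z}, {y}) \<in> \<alpha>"
      by blast
  next
    assume "\<exists>z. ({x}, {z}) \<in> \<beta> \<and> ({z}, {y}) \<in> \<alpha>"
    then obtain z where z: "({x}, {z}) \<in> \<beta>" "({z}, {y}) \<in> \<alpha>"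
      by blast
    have "{z} \<in> ?J"
      using z by (intro singleton_in_join parts) auto
    moreover have "?pre {z} = {{x}}"
      using z(1) sv\<beta>(2) ne by (auto simp: single_valued_def subset_singleton_iff)
    moreover have "?img {z} = {{y}}"
      using z(2) sv\<alpha>(1) ne by (auto simp: single_valued_def subset_singleton_iff)
    ultimately show "({x}, {y}) \<in> dual_mult n \<alpha> \<beta>"
      unfolding mult by (intro bexI[of _ "{z}"]) auto
  qed
  then show ?thesis
    unfolding upsilon_def by auto
qed

lemma upsilon_hom: "upsilon \<in> hom (F_star n) (IS n)"
proof (rule homI)
  fix \<alpha> \<beta> assume "\<alpha> \<in> carrier (F_star n)" "\<beta> \<in> carrier (F_star n)"
  then have "upsilon (dual_mult n \<alpha> \<beta>) = upsilon \<beta> O upsilon \<alpha>"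
    by (rule upsilon_dual_mult)
  then show "upsilon (\<alpha> \<otimes>\<^bsub>F_star n\<^esub> \<beta>) = upsilon \<alpha> \<otimes>\<^bsub>IS n\<^esub> upsilon \<beta>"
    by (simp add: F_star_def I_star_def IS_def)
qed (rule upsilon_in_carrier_IS)

lemma upsilon_one: "upsilon \<one>\<^bsub>F_star n\<^esub> = \<one>\<^bsub>IS n\<^esub>"
  by (auto simp: upsilon_def F_star_def I_star_def IS_def)

section \<open>The image\<close>

text \<open>
  If just one point \<open>c\<close> were missing from the domain, every other point would already form a
  block of its own, so that nothing but \<open>c\<close> is left for the block of \<open>c\<close>.
\<close>

lemma rank_upsilon:
  assumes n: "n \<ge> 1" and \<alpha>: "\<alpha> \<in> carrier (F_star n)"
  shows "rank (upsilon \<alpha>) \<noteq> n - 1"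
proof
  assume rank: "rank (upsilon \<alpha>) = n - 1"
  have P: "partition_on {1..n} (Domain \<alpha>)" and card: "\<And>A B. (A, B) \<in> \<alpha> \<Longrightarrow> card A = card B"
    using \<alpha> by (auto simp: mem_carrier_F_star_iff)
  have sub: "Domain (upsilon \<alpha>) \<subseteq> {1..n}"
    using upsilon_in_carrier_IS[OF \<alpha>] by (simp add: mem_carrier_IS_iff)
  then have "card ({1..n} - Domain (upsilon \<alpha>)) = 1"
    using rank n by (simp add: card_Diff_subset finite_subset rank_def)
  then obtain c where c: "{1..n} - Domain (upsilon \<alpha>) = {c}"
    by (auto simp: card_1_singleton_iff)
  have "c \<in> \<Union>(Domain \<alpha>)"
    using c partition_onD1[OF P] by blast
  then obtain X Y where X: "(X, Y) \<in> \<alpha>" "c \<in> X"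
    by blast
  have "X \<subseteq> {c}"
  proof
    fix d assume d: "d \<in> X"
    show "d \<in> {c}"
    proof (rule ccontr)
      assume "d \<notin> {c}"
      moreover have "d \<in> {1..n}"
        using d X(1) partition_onD1[OF P] by blast
      ultimately have "{d} \<in> Domain \<alpha>"
        using c by (auto simp: upsilon_def)
      then have "X = {d}"
        using d X(1) disjointD[OF partition_onD2[OF P]] by blast
      with X(2) \<open>d \<notin> {c}\<close> show False
        by simp
    qed
  qed
  with X have "X = {c}"
    by blast
  moreover from this obtain e where "Y = {e}"
    using card[OF X(1)] by (metis card_1_singletonE is_singletonI is_singleton_altdef)
  ultimately have "c \<in> Domain (upsilon \<alpha>)"
    using X(1) by (auto simp: upsilon_def)
  with c show False
    by blast
qed

text \<open>
  Removing the pair of empty sets covers the case of a permutation, where both complements are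
  empty and must not be counted as blocks.
\<close>

definition complete_blocks :: "'a set \<Rightarrow> ('a \<times> 'a) set \<Rightarrow> ('a set \<times> 'a set) set" where
  "complete_blocks S \<sigma> =
     {({x}, {y}) | x y. (x, y) \<in> \<sigma>} \<union> ({(S - Domain \<sigma>, S - Range \<sigma>)} - {({}, {})})"

lemma partition_on_singletons_and_complement:
  assumes "A \<subseteq> S"
  shows "partition_on S ((\<lambda>x. {x}) ` A \<union> ({S - A} - {{}}))"
  using assms unfolding partition_on_def disjoint_def by auto

context
  fixes n :: nat and \<sigma> :: "(nat \<times> nat) set"
  assumes \<sigma>: "\<sigma> \<in> carrier (IS n)"
begin

lemma card_complements:
  "card ({1..n} - Domain \<sigma>) = n - rank \<sigma>" "card ({1..n} - Range \<sigma>) = n - rank \<sigma>"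
proof -
  have sub: "Domain \<sigma> \<subseteq> {1..n}" "Range \<sigma> \<subseteq> {1..n}"
    using \<sigma> by (auto simp: mem_carrier_IS_iff)
  have "\<sigma> \<in> bij_graphs (Domain \<sigma>) (Range \<sigma>)"
    using \<sigma> by (simp add: mem_carrier_IS_iff mem_bij_graphs_iff)
  then have "card (Range \<sigma>) = rank \<sigma>"
    by (simp add: card_eq_of_bij_graph rank_def)
  with sub show "card ({1..n} - Domain \<sigma>) = n - rank \<sigma>" "card ({1..n} - Range \<sigma>) = n - rank \<sigma>"
    by (simp_all add: card_Diff_subset finite_subset rank_def)
qed

lemma complements_empty_iff: "{1..n} - Domain \<sigma> = {} \<longleftrightarrow> {1..n} - Range \<sigma> = {}"
  using card_complements by (metis card_0_eq finite_Diff finite_atLeastAtMost)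

lemma complete_blocks_in_carrier_F_star: "complete_blocks {1..n} \<sigma> \<in> carrier (F_star n)"
  unfolding mem_carrier_F_star_iff
proof (intro conjI)
  let ?C = "{1..n} - Domain \<sigma>" and ?D = "{1..n} - Range \<sigma>"
  have sub: "Domain \<sigma> \<subseteq> {1..n}" "Range \<sigma> \<subseteq> {1..n}"
    and sv: "single_valued \<sigma>" "single_valued (\<sigma>\<inverse>)"
    using \<sigma> by (auto simp: mem_carrier_IS_iff)
  have "Domain ({(C, D)} - {({}, {})}) = {C} - {{}} \<and> Range ({(C, D)} - {({}, {})}) = {D} - {{}}"
    if "C = {} \<longleftrightarrow> D = {}" for C D :: "nat set"
    using that by auto
  note compl = this[OF complements_empty_iff]
  have "Domain {({x}, {y}) | x y. (x, y) \<in> \<sigma>} = (\<lambda>x. {x}) ` Domain \<sigma>"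
    "Range {({x}, {y}) | x y. (x, y) \<in> \<sigma>} = (\<lambda>y. {y}) ` Range \<sigma>"
    by blast+
  with compl have "Domain (complete_blocks {1..n} \<sigma>) = (\<lambda>x. {x}) ` Domain \<sigma> \<union> ({?C} - {{}})"
    "Range (complete_blocks {1..n} \<sigma>) = (\<lambda>y. {y}) ` Range \<sigma> \<union> ({?D} - {{}})"
    unfolding complete_blocks_def Domain_Un_eq Range_Un_eq by argo+
  then show "partition_on {1..n} (Domain (complete_blocks {1..n} \<sigma>))"
    "partition_on {1..n} (Range (complete_blocks {1..n} \<sigma>))"
    using partition_on_singletons_and_complement sub by metis+
  have "{x} \<noteq> ?C" "{y} \<noteq> ?D" if "(x, y) \<in> \<sigma>" for x y
    using that by blast+
  then show "single_valued (complete_blocks {1..n} \<sigma>)"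
    "single_valued ((complete_blocks {1..n} \<sigma>)\<inverse>)"
    using sv unfolding single_valued_def complete_blocks_def by blast+
  show "\<forall>(A, B) \<in> complete_blocks {1..n} \<sigma>. card A = card B"
    using card_complements unfolding complete_blocks_def by auto
qed

lemma upsilon_complete_blocks:
  assumes "n \<ge> 1" and "rank \<sigma> \<noteq> n - 1"
  shows "upsilon (complete_blocks {1..n} \<sigma>) = \<sigma>"
proof -
  have "card ({1..n} - Domain \<sigma>) \<noteq> 1"
    using card_complements(1) assms by linarith
  then have "{x} \<noteq> {1..n} - Domain \<sigma>" for x
    by (metis is_singletonI is_singleton_altdef)
  then show ?thesis
    unfolding upsilon_def complete_blocks_def by blast
qed

end

lemma upsilon_image:
  assumes "n \<ge> 1"
  shows "upsilon ` carrier (F_star n) = carrier (IS_tilde n)"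
proof
  show "upsilon ` carrier (F_star n) \<subseteq> carrier (IS_tilde n)"
    using upsilon_in_carrier_IS rank_upsilon[OF assms] by (auto simp: IS_tilde_def)
  show "carrier (IS_tilde n) \<subseteq> upsilon ` carrier (F_star n)"
  proof
    fix \<sigma> assume "\<sigma> \<in> carrier (IS_tilde n)"
    then have \<sigma>: "\<sigma> \<in> carrier (IS n)" "rank \<sigma> \<noteq> n - 1"
      by (auto simp: IS_tilde_def)
    show "\<sigma> \<in> upsilon ` carrier (F_star n)"
      using upsilon_complete_blocks[OF \<sigma>(1) assms \<sigma>(2)]
        complete_blocks_in_carrier_F_star[OF \<sigma>(1)]
      by (metis imageI)
  qed
qed

theorem lemma15:
  fixes n :: nat
  assumes "n \<ge> 1"
  shows "upsilon \<in> hom (F_star n) (IS n)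
    \<and> upsilon \<one>\<^bsub>F_star n\<^esub> = \<one>\<^bsub>IS n\<^esub>
    \<and> upsilon ` carrier (F_star n) = carrier (IS_tilde n)"
  using upsilon_hom upsilon_one upsilon_image[OF assms] by blast

end
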